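(* Let $G$ be a finite group and $\rho: G\to \mathrm{GL}_{n_3}(\mathbb{R})$ a totally real representation with $\rho(g)$ orthogonal for each $g\in G$. Let $\mathbb{C}^{n_3} \simeq V_1\oplus\cdots\oplus V_m$ be the decomposition into irreducibles, $d_j = \dim V_j$, let $M \in \mathrm{O}_{n_3}(\mathbb{R})$ represent a change of basis to a symmetry-adapted basis, and let $W_\rho \subseteq \mathbb{R}^{1\times1\times n_3}$ be the space of tubes $\mathbf{x}$ such that $\mathrm{diag}(M\mathrm{vec}(\mathbf{x}))$ is block diagonal with diagonal blocks $c_1I_{d_1},\dots,c_mI_{d_m}$ for some scalars $c_1,\dots,c_m$. Let $U \subseteq \mathbb{R}^{n\times n\times n_3}$ be the vector space of symmetric tensors all of whose tubes are elements of $W_\rho$. Then for any symmetric tensors $\mathcal{C}, \mathcal{A}^{(1)},\dots,\mathcal{A}^{(L)} \in \mathbb{R}^{n\times n\times n_3}$ and any scalars $b^{(1)},\dots,b^{(L)}\in\mathbb{R}$, the $M$-SDP $$\max_{\mathcal{X}}\ \langle \mathcal{C},\mathcal{X}\rangle \quad \text{s.t.}\quad \langle \mathcal{A}^{(\ell)},\mathcal{X}\rangle = b^{(\ell)} \text{ for } \ell = 1,\dots,L,\quad \mathcal{X}\in \mathrm{PSD}_M^n\cap U$$ is an invariant $M$-SDP with respect to the representation $\hat\rho: G\to \mathrm{GL}_{nn_3}(\mathbb{R})$ given by $\hat\rho(g) = I_n\otimes\rho(g)$, where $\otimes$ is the Kronecker product.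
   Context: $\mathrm{O}_{n_3}(\mathbb{R})$ is the group of real orthogonal $n_3\times n_3$ matrices. A tube is an element $\mathbf{a}\in\mathbb{R}^{1\times1\times n_3}$; $\mathrm{vec}(\mathbf{a})\in\mathbb{R}^{n_3}$ has entries $\mathbf{a}_{1,1,k}$, and $\mathrm{tube}$ is the inverse of $\mathrm{vec}$; $\mathrm{diag}(v)$ is the diagonal matrix with diagonal $v$. The $\star_M$-product of tubes is $\mathbf{a}\star_M\mathbf{b} = \mathrm{tube}(M^{-1}\mathrm{diag}(M\mathrm{vec}(\mathbf{a}))M\mathrm{vec}(\mathbf{b}))$; tensors in $\mathbb{R}^{n_1\times n_2\times n_3}$ are viewed as $n_1\times n_2$ matrices of tubes $\mathcal{A}_{i,j,:}$ and $(\mathcal{A}\star_M\mathcal{B})_{i,j,:}=\sum_\ell \mathcal{A}_{i,\ell,:}\star_M\mathcal{B}_{\ell,j,:}$. The inner product is $\langle\mathcal{A},\mathcal{B}\rangle=\sum_{i,j,k}\mathcal{A}_{i,j,k}\mathcal{B}_{i,j,k}$. A tensor $\mathcal{A}\in\mathbb{R}^{n\times n\times n_3}$ is symmetric if every frontal slice $\mathcal{A}_{:,:,k}$ is symmetric. $\mathrm{PSD}_M^n$ is the set of symmetric $\mathcal{A}\in\mathbb{R}^{n\times n\times n_3}$ with $\langle\mathcal{Y},\mathcal{A}\star_M\mathcal{Y}\rangle\ge0$ for all $\mathcal{Y}\in\mathbb{R}^{n\times1\times n_3}$. A complex representation $V$ is real if $V=V_0\otimes\mathbb{C}$ for a real representation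 $V_0$; it is totally real if each irreducible summand $V_i$ in its decomposition into (complex) irreducibles is real. For a real $\rho$ this is applied to the complexification $\mathbb{C}^{n_3}$. Symmetry-adapted basis: for $V=V_1\oplus\cdots\oplus V_m$ decomposed into irreducibles with $\dim V_i=d_i$, an ordered basis formed by concatenating ordered bases $\{v_1^{(i)},\dots,v_{d_i}^{(i)}\}$ of $V_i$, $i=1,\dots,m$, such that for every $\rho$-equivariant linear $T:V\to V$ the matrix of $T$ in this basis has blocks $T_{i,j}:V_i\to V_j$ each equal to $c_{i,j}I$ for a scalar $c_{i,j}$ or to $0$. "$M$ represents a change of basis to a symmetry-adapted basis" means that the columns of $M^{-1}$, in order, are the vectors of the symmetry-adapted basis (so $M\rho(g)M^{-1}$ is block diagonal with blocks of sizes $d_1,\dots,d_m$). Invariance: a tensor $\mathcal{X}\in\mathbb{R}^{n\times n\times n_3}$ has the $nn_3\times nn_3$ matrix representative $\hat X$ whose $(i,j)$ block ($n_3\times n_3$) is $M^\top\mathrm{diag}(M\mathrm{vec}(\mathcal{X}_{i,j,:}))M$; this is the matrix of the map $\mathcal{Y}\mapsto\mathcal{X}\star_M\mathcal{Y}$ on $\mathbb{R}^{n\times1\times n_3}\cong\mathbb{R}^{nn_3}$ (stacking the vectorized tubes). A matrix SDP over symmetric $N\times N$ matrices with cost matrix $C$ and feasible region $\Omega$ is invariant with respect to a representation $\hat\rho:G\to\mathrm{GL}_N(\mathbb{R})$, acting by $g\cdot X=\hat\rho(g)^\top X\hat\rho(g)$, if $g\cdot\Omega=\Omega$ for all $g\in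 G$ and $\langle C,g\cdot X\rangle=\langle C,X\rangle$ for all $g\in G$, $X\in\Omega$ (with $\langle A,B\rangle=\mathrm{trace}(A^\top B)$). The $M$-SDP is invariant with respect to $\hat\rho$ if the matrix SDP obtained from it by replacing all tensors $\mathcal{X},\mathcal{C},\mathcal{A}^{(\ell)}$ by their matrix representatives $\hat X,\hat C,\hat A^{(\ell)}$ has the same objective and constraint values (i.e. $\langle\mathcal{B},\mathcal{X}\rangle=\mathrm{trace}(\hat B\hat X)$ for $\mathcal{B}=\mathcal{C},\mathcal{A}^{(\ell)}$ and feasible $\mathcal{X}$) and is an invariant matrix SDP with respect to $\hat\rho$. *)

theory Defs
  imports "HOL-Analysis.Analysis" "HOL-Algebra.Group"
begin

section \<open>Representations\<close>

definition GL :: "(real^'n^'n) monoid" where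
  "GL = \<lparr>carrier = {A. invertible A}, mult = (**), one = mat 1\<rparr>"

definition cvec :: "real^'k \<Rightarrow> complex^'k" where
  "cvec x = (\<chi> i. complex_of_real (x $ i))"

definition complexification :: "('g \<Rightarrow> real^'k^'k) \<Rightarrow> 'g \<Rightarrow> complex^'k^'k" where
  "complexification \<rho> g = (\<chi> i j. complex_of_real (\<rho> g $ i $ j))"

definition invariant_under :: "('g, 'h) monoid_scheme \<Rightarrow> ('g \<Rightarrow> complex^'k^'k) \<Rightarrow> (complex^'k) set \<Rightarrow> bool"
  where "invariant_under G \<sigma> V \<longleftrightarrow> (\<forall>g\<in>carrier G. \<forall>v\<in>V. \<sigma> g *v v \<in> V)"

text \<open>
  Over \<^typ>\<open>complex\<close>, \<^term>\<open>vec.subspace\<close>, \<^term>\<open>vec.span\<close>, \<^term>\<open>vec.independent\<close> and \<^term>\<open>vec.dim\<close>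
  are the complex-linear notions, whereas \<^term>\<open>subspace\<close> is the real-linear one.
\<close>

definition irreducible_subrep :: "('g, 'h) monoid_scheme \<Rightarrow> ('g \<Rightarrow> complex^'k^'k) \<Rightarrow> (complex^'k) set \<Rightarrow> bool"
  where "irreducible_subrep G \<sigma> V \<longleftrightarrow>
    vec.subspace V \<and> invariant_under G \<sigma> V \<and> V \<noteq> {0} \<and>
    (\<forall>W. vec.subspace W \<and> invariant_under G \<sigma> W \<and> W \<subseteq> V \<longrightarrow> W = {0} \<or> W = V)"

definition irreducible_decomposition ::
  "('g, 'h) monoid_scheme \<Rightarrow> ('g \<Rightarrow> complex^'k^'k) \<Rightarrow> (complex^'k) set list \<Rightarrow> bool"
  where "irreducible_decomposition G \<sigma> Vs \<longleftrightarrow>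
    (\<forall>V\<in>set Vs. irreducible_subrep G \<sigma> V) \<and>
    (\<forall>v. \<exists>!xs. length xs = length Vs \<and> (\<forall>i<length Vs. xs ! i \<in> Vs ! i) \<and> sum_list xs = v)"

text \<open>
  \<open>V = V\<^sub>0 \<otimes> \<complex>\<close> for a real representation \<open>V\<^sub>0\<close>: the group-invariant real subspace \<open>V0\<close> of \<open>V\<close> is such that
  the canonical map \<open>V\<^sub>0 \<otimes> \<complex> \<rightarrow> V\<close>, \<open>x \<otimes> 1 + y \<otimes> \<i> \<mapsto> x + \<i> y\<close>, is bijective.
\<close>

definition real_subrep :: "('g, 'h) monoid_scheme \<Rightarrow> ('g \<Rightarrow> complex^'k^'k) \<Rightarrow> (complex^'k) set \<Rightarrow> bool"
  where "real_subrep G \<sigma> V \<longleftrightarrow>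
    (\<exists>V0. subspace V0 \<and> V0 \<subseteq> V \<and> invariant_under G \<sigma> V0 \<and>
      (\<forall>v\<in>V. \<exists>!(x, y). x \<in> V0 \<and> y \<in> V0 \<and> v = x + \<i> *s y))"

definition totally_real :: "('g, 'h) monoid_scheme \<Rightarrow> ('g \<Rightarrow> complex^'k^'k) \<Rightarrow> bool" where
  "totally_real G \<sigma> \<longleftrightarrow>
    (\<forall>Vs. irreducible_decomposition G \<sigma> Vs \<longrightarrow> (\<forall>V\<in>set Vs. real_subrep G \<sigma> V))"

definition equivariant :: "('g, 'h) monoid_scheme \<Rightarrow> ('g \<Rightarrow> complex^'k^'k) \<Rightarrow> (complex^'k \<Rightarrow> complex^'k) \<Rightarrow> bool"
  where "equivariant G \<sigma> T \<longleftrightarrow>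
    Vector_Spaces.linear (*s) (*s) T \<and> (\<forall>g\<in>carrier G. \<forall>v. T (\<sigma> g *v v) = \<sigma> g *v T v)"

text \<open>
  \<open>bs ! i\<close> lists the basis of \<open>Vs ! i\<close>; the ordered basis of the whole space is \<open>concat bs\<close>.
  In the last clause, \<open>vec.representation B v b\<close> is the coefficient of \<open>v\<close> at the basis vector \<open>b\<close>, so
  that the block \<open>T\<^sub>i\<^sub>j\<close> is required to be \<open>0\<close> or (being square) of the form \<open>c I\<close>.
\<close>

definition symmetry_adapted_basis ::
  "('g, 'h) monoid_scheme \<Rightarrow> ('g \<Rightarrow> complex^'k^'k) \<Rightarrow> (complex^'k) set list \<Rightarrow> (complex^'k) list list \<Rightarrow> bool"
  where "symmetry_adapted_basis G \<sigma> Vs bs \<longleftrightarrow>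
    length bs = length Vs \<and>
    (\<forall>i<length Vs. distinct (bs ! i) \<and> vec.independent (set (bs ! i)) \<and> vec.span (set (bs ! i)) = Vs ! i) \<and>
    (\<forall>T. equivariant G \<sigma> T \<longrightarrow>
      (\<forall>i<length bs. \<forall>j<length bs.
        (\<forall>a<length (bs ! i). \<forall>b<length (bs ! j).
          vec.representation (set (concat bs)) (T (bs ! i ! a)) (bs ! j ! b) = 0) \<or>
        length (bs ! i) = length (bs ! j) \<and>
        (\<exists>c. \<forall>a<length (bs ! i). \<forall>b<length (bs ! j).
          vec.representation (set (concat bs)) (T (bs ! i ! a)) (bs ! j ! b) = (if a = b then c else 0))))"

text \<open>
  The index type \<open>'k\<close> of the basis carries a linear order, and \<open>pos k\<close> is the zero-based position of
  the index \<open>k\<close> in that order.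
\<close>

definition pos :: "'k::{finite,linorder} \<Rightarrow> nat" where
  "pos k = card {l. l < k}"

definition represents_symmetry_adapted ::
  "('g, 'h) monoid_scheme \<Rightarrow> ('g \<Rightarrow> real^'k::{finite,linorder}^'k::{finite,linorder}) \<Rightarrow>
    (complex^'k::{finite,linorder}) set list \<Rightarrow> real^'k::{finite,linorder}^'k::{finite,linorder} \<Rightarrow> bool"
  where "represents_symmetry_adapted G \<rho> Vs M \<longleftrightarrow>
    (\<exists>bs. symmetry_adapted_basis G (complexification \<rho>) Vs bs \<and> length (concat bs) = CARD('k) \<and>
      (\<forall>k. cvec (column k (matrix_inv M)) = concat bs ! pos k))"


section \<open>Tensors and the \<open>M\<close>-product\<close>

type_synonym ('n1, 'n2, 'k) tensor = "real^'k^'n2^'n1"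

type_synonym 'k tube = "(1, 1, 'k) tensor"

definition tvec :: "'k::finite tube \<Rightarrow> real^'k" where
  "tvec a = a $ 1 $ 1"

definition tube :: "real^'k \<Rightarrow> 'k tube" where
  "tube v = (\<chi> _ _. v)"

definition tube_at :: "('n1::finite, 'n2::finite, 'k::finite) tensor \<Rightarrow> 'n1 \<Rightarrow> 'n2 \<Rightarrow> 'k tube" where
  "tube_at A i j = tube (A $ i $ j)"

definition diag :: "real^'k \<Rightarrow> real^'k^'k" where
  "diag v = (\<chi> i j. if i = j then v $ i else 0)"

definition tube_prod :: "real^'k^'k \<Rightarrow> 'k tube \<Rightarrow> 'k tube \<Rightarrow> 'k tube" where
  "tube_prod M a b = tube (matrix_inv M *v (diag (M *v tvec a) *v (M *v tvec b)))"

definition tensor_prod ::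
  "real^'k^'k \<Rightarrow> ('n1::finite, 'n2::finite, 'k) tensor \<Rightarrow> ('n2, 'n3::finite, 'k) tensor \<Rightarrow> ('n1, 'n3, 'k) tensor" where
  "tensor_prod M A B = (\<chi> i j. tvec (\<Sum>l\<in>UNIV. tube_prod M (tube_at A i l) (tube_at B l j)))"

definition frontal_slice :: "('n1, 'n2, 'k::finite) tensor \<Rightarrow> 'k \<Rightarrow> real^'n2^'n1" where
  "frontal_slice A k = (\<chi> i j. A $ i $ j $ k)"

definition symmetric_tensor :: "('n::finite, 'n, 'k::finite) tensor \<Rightarrow> bool" where
  "symmetric_tensor A \<longleftrightarrow> (\<forall>k. transpose (frontal_slice A k) = frontal_slice A k)"

text \<open>
  The inner product \<open>\<Sum>\<^sub>i\<^sub>j\<^sub>k A\<^sub>i\<^sub>j\<^sub>k B\<^sub>i\<^sub>j\<^sub>k\<close> of tensors is the library's \<^const>\<open>inner\<close> on nested vectors.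
\<close>

definition PSD :: "real^'k^'k \<Rightarrow> ('n::finite, 'n, 'k) tensor set" where
  "PSD M = {A. symmetric_tensor A \<and> (\<forall>Y :: ('n, 1, 'k) tensor. inner Y (tensor_prod M A Y) \<ge> 0)}"

definition block_scalar :: "nat list \<Rightarrow> real list \<Rightarrow> real^'k::{finite,linorder}^'k::{finite,linorder}" where
  "block_scalar ds cs = diag (\<chi> k. concat (map2 replicate ds cs) ! pos k)"

definition W_space :: "real^'k::{finite,linorder}^'k::{finite,linorder} \<Rightarrow> nat list \<Rightarrow> 'k tube set" where
  "W_space M ds = {x. \<exists>cs. length cs = length ds \<and> diag (M *v tvec x) = block_scalar ds cs}"

definition U_space :: "'k::finite tube set \<Rightarrow> ('n::finite, 'n, 'k) tensor set" where
  "U_space W = {X. symmetric_tensor X \<and> (\<forall>i j. tube_at X i j \<in> W)}"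


section \<open>Semidefinite programs and invariance\<close>

definition psd_matrix :: "real^'N^'N \<Rightarrow> bool" where
  "psd_matrix X \<longleftrightarrow> transpose X = X \<and> (\<forall>y. inner y (X *v y) \<ge> 0)"

text \<open>Cost matrix \<open>C\<close>, feasible region \<open>\<Omega>\<close>.\<close>

definition matrix_sdp :: "real^'N^'N \<Rightarrow> (real^'N^'N) set \<Rightarrow> bool" where
  "matrix_sdp C \<Omega> \<longleftrightarrow> transpose C = C \<and> (\<exists>S. affine S \<and> \<Omega> = {X \<in> S. psd_matrix X})"

definition act :: "real^'N^'N \<Rightarrow> real^'N^'N \<Rightarrow> real^'N^'N" where
  "act P X = transpose P ** X ** P"

definition invariant_matrix_sdp ::
  "('g, 'h) monoid_scheme \<Rightarrow> ('g \<Rightarrow> real^'N^'N) \<Rightarrow> real^'N^'N \<Rightarrow> (real^'N^'N) set \<Rightarrow> bool" where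
  "invariant_matrix_sdp G r C \<Omega> \<longleftrightarrow>
    r \<in> hom G GL \<and> matrix_sdp C \<Omega> \<and>
    (\<forall>g\<in>carrier G. act (r g) ` \<Omega> = \<Omega>) \<and>
    (\<forall>g\<in>carrier G. \<forall>X\<in>\<Omega>. trace (transpose C ** act (r g) X) = trace (transpose C ** X))"

text \<open>Block \<open>(i, j)\<close> has entries \<open>((i, k), (j, l))\<close>.\<close>

definition mat_rep :: "real^'k^'k \<Rightarrow> ('n::finite, 'n, 'k) tensor \<Rightarrow> real^('n \<times> 'k)^('n \<times> 'k)" where
  "mat_rep M X = (\<chi> p q.
    (transpose M ** diag (M *v tvec (tube_at X (fst p) (fst q))) ** M) $ snd p $ snd q)"

definition kronecker :: "real^'n^'n \<Rightarrow> real^'k^'k \<Rightarrow> real^('n \<times> 'k)^('n \<times> 'k)" where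
  "kronecker A B = (\<chi> p q. A $ fst p $ fst q * B $ snd p $ snd q)"

text \<open>
  The \<open>M\<close>-SDP of maximising \<open>inner C X\<close> subject to \<open>inner (A l) X = b l\<close> for \<open>l = 1, \<dots>, L\<close> and
  \<open>X \<in> PSD M \<inter> U\<close>, and the feasible region of the matrix SDP obtained from it by replacing tensors
  with their matrix representatives.
\<close>

definition feasible_tensors ::
  "real^'k^'k \<Rightarrow> nat \<Rightarrow> (nat \<Rightarrow> ('n::finite, 'n, 'k) tensor) \<Rightarrow> (nat \<Rightarrow> real) \<Rightarrow> ('n, 'n, 'k) tensor set \<Rightarrow>
    ('n, 'n, 'k) tensor set" where
  "feasible_tensors M L A b U = {X \<in> PSD M \<inter> U. \<forall>l\<in>{1..L}. inner (A l) X = b l}"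

definition feasible_matrices ::
  "real^'k^'k \<Rightarrow> nat \<Rightarrow> (nat \<Rightarrow> ('n::finite, 'n, 'k) tensor) \<Rightarrow> (nat \<Rightarrow> real) \<Rightarrow> ('n, 'n, 'k) tensor set \<Rightarrow>
    (real^('n \<times> 'k)^('n \<times> 'k)) set" where
  "feasible_matrices M L A b U =
    {Z \<in> mat_rep M ` (PSD M \<inter> U). \<forall>l\<in>{1..L}. trace (transpose (mat_rep M (A l)) ** Z) = b l}"

definition invariant_M_sdp ::
  "('g, 'h) monoid_scheme \<Rightarrow> ('g \<Rightarrow> real^('n \<times> 'k)^('n \<times> 'k)) \<Rightarrow> real^'k^'k \<Rightarrow> ('n::finite, 'n, 'k) tensor \<Rightarrow>
    nat \<Rightarrow> (nat \<Rightarrow> ('n, 'n, 'k) tensor) \<Rightarrow> (nat \<Rightarrow> real) \<Rightarrow> ('n, 'n, 'k) tensor set \<Rightarrow> bool" where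
  "invariant_M_sdp G r M C L A b U \<longleftrightarrow>
    (\<forall>X\<in>feasible_tensors M L A b U.
      inner C X = trace (mat_rep M C ** mat_rep M X) \<and>
      (\<forall>l\<in>{1..L}. inner (A l) X = trace (mat_rep M (A l) ** mat_rep M X))) \<and>
    invariant_matrix_sdp G r (mat_rep M C) (feasible_matrices M L A b U)"

end

theory Submission
  imports Defs
begin

text \<open>
  A block of \<open>mat_rep M X\<close> has the form \<open>M\<^sup>T D M\<close> with \<open>D\<close> diagonal. For a tube in \<open>W_space\<close>, \<open>D\<close> is constant
  on each block of the symmetry-adapted basis, that is, \<open>M\<^sup>T D M\<close> acts as a scalar on each
  irreducible summand, and therefore commutes with \<open>\<rho> g\<close>. Hence every feasible matrix commutes with
  \<open>I \<otimes> \<rho> g\<close>, and since the latter is orthogonal the group acts trivially on the feasible region.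
\<close>

section \<open>Kronecker products and matrix representatives\<close>

lemma sum_UNIV_prod:
  fixes f :: "'a::finite \<times> 'b::finite \<Rightarrow> 'c::comm_monoid_add"
  shows "(\<Sum>p\<in>UNIV. f p) = (\<Sum>i\<in>UNIV. \<Sum>k\<in>UNIV. f (i, k))"
  by (simp add: UNIV_Times_UNIV [symmetric] sum.cartesian_product del: UNIV_Times_UNIV)

lemma kronecker_mult:
  "kronecker A B ** kronecker C D = kronecker (A ** C) (B ** D)"
  by (simp add: vec_eq_iff kronecker_def matrix_matrix_mult_def sum_UNIV_prod sum_product mult_ac)

lemma kronecker_mat_1: "kronecker (mat 1) (mat 1) = mat 1"
  by (auto simp: vec_eq_iff kronecker_def mat_def)

lemma transpose_kronecker: "transpose (kronecker A B) = kronecker (transpose A) (transpose B)"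
  by (simp add: vec_eq_iff kronecker_def transpose_def)

lemma invertible_kronecker:
  assumes "invertible A" and "invertible B"
  shows "invertible (kronecker A B)"
proof -
  obtain A' B' where "A ** A' = mat 1" "A' ** A = mat 1" "B ** B' = mat 1" "B' ** B = mat 1"
    using assms unfolding invertible_def by blast
  then show ?thesis
    unfolding invertible_def
    by (intro exI [of _ "kronecker A' B'"]) (simp add: kronecker_mult kronecker_mat_1)
qed

lemma kronecker_hom:
  assumes "\<rho> \<in> hom G GL"
  shows "(\<lambda>g. kronecker (mat 1) (\<rho> g)) \<in> hom G GL"
  using assms by (auto simp: hom_def GL_def Pi_iff kronecker_mult invertible_kronecker
      invertible_def [of "mat 1"])

text \<open>Lets trace constraints be treated as hyperplanes for the library's
  \<open>inner\<close>.\<close>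

lemma trace_transpose_mult: "trace (transpose A ** B) = inner A (B :: real^'n^'n)"
proof -
  have "trace (transpose A ** B) = (\<Sum>i\<in>UNIV. \<Sum>j\<in>UNIV. A $ j $ i * B $ j $ i)"
    by (simp add: trace_def matrix_matrix_mult_def transpose_def)
  also have "\<dots> = inner A B"
    by (subst sum.swap) (simp add: inner_vec_def)
  finally show ?thesis .
qed

text \<open>For orthogonal \<open>M\<close>, \<open>transpose M\<close> is the inverse of
  \<open>M\<close>, so this is the matrix of left multiplication by the tube with vector
  \<open>x\<close>.\<close>

definition tube_rep :: "real^'k^'k \<Rightarrow> real^'k \<Rightarrow> real^'k^'k" where
  "tube_rep M x = transpose M ** diag (M *v x) ** M"

lemma mat_rep_nth: "mat_rep M X $ (i, a) $ (j, c) = tube_rep M (X $ i $ j) $ a $ c"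
  by (simp add: mat_rep_def tube_rep_def tube_at_def tvec_def tube_def)

lemma diag_mult_nth: "(diag v ** A) $ i $ j = v $ i * A $ i $ j"
  by (simp add: diag_def matrix_matrix_mult_def if_distrib [of "\<lambda>x. x * _"] cong: if_cong)

lemma mult_diag_nth: "(A ** diag v) $ i $ j = A $ i $ j * v $ j"
  by (simp add: diag_def matrix_matrix_mult_def if_distrib [of "\<lambda>x. _ * x"] cong: if_cong)

lemma diag_mult: "diag u ** diag v = diag (\<chi> i. u $ i * v $ i)"
  by (simp add: vec_eq_iff diag_mult_nth) (simp add: diag_def)

lemma transpose_diag: "transpose (diag v) = diag v"
  by (auto simp: vec_eq_iff diag_def transpose_def)

lemma diag_inject: "diag u = diag v \<longleftrightarrow> u = v"
proof
  assume "diag u = diag v"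
  then have "diag u $ i $ i = diag v $ i $ i" for i
    by simp
  then show "u = v"
    by (simp add: diag_def vec_eq_iff)
qed simp

lemma transpose_tube_rep: "transpose (tube_rep M x) = tube_rep M x"
  by (simp add: tube_rep_def matrix_transpose_mul transpose_diag matrix_mul_assoc)

lemma tube_rep_nth:
  "tube_rep M x $ a $ c = (\<Sum>k\<in>UNIV. M $ k $ a * (M *v x) $ k * M $ k $ c)"
  by (simp add: tube_rep_def matrix_matrix_mult_def transpose_def diag_def
      if_distrib [of "\<lambda>x. x * _"] if_distrib [of "\<lambda>x. _ * x"] cong: if_cong)

lemma linear_tube_rep: "linear (tube_rep M)"
  by (rule linearI)
    (simp_all add: vec_eq_iff tube_rep_nth matrix_vector_right_distrib matrix_vector_mult_scaleR
      algebra_simps sum.distrib sum_distrib_left)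

lemma linear_mat_rep: "linear (mat_rep M)"
  by (rule linearI)
    (auto simp: vec_eq_iff mat_rep_nth linear_add [OF linear_tube_rep] linear_scale [OF linear_tube_rep])

lemma symmetric_tensor_iff: "symmetric_tensor X \<longleftrightarrow> (\<forall>i j. X $ i $ j = X $ j $ i)"
  by (auto simp: symmetric_tensor_def frontal_slice_def transpose_def vec_eq_iff)

text \<open>Two symmetries combine: tensor symmetry equates the blocks at \<open>(i, j)\<close> and
  \<open>(j, i)\<close>, and each block is itself a symmetric matrix.\<close>

lemma transpose_mat_rep:
  assumes "symmetric_tensor X"
  shows "transpose (mat_rep M X) = mat_rep M X"
proof -
  have "tube_rep M (X $ j $ i) $ c $ a = tube_rep M (X $ i $ j) $ a $ c" for i j a c
    using assms by (simp add: symmetric_tensor_iff tube_rep_nth mult_ac)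
  then show ?thesis
    by (simp add: vec_eq_iff transpose_def mat_rep_nth)
qed

text \<open>Conjugation by an orthogonal matrix cancels inside the trace. What remains is the trace
  of two diagonal matrices, the dot product of \<open>M *v x\<close> and \<open>M *v y\<close>, and
  \<open>M\<close> is an isometry.\<close>

lemma inner_tube_rep:
  assumes "orthogonal_matrix M"
  shows "inner (tube_rep M x) (tube_rep M y) = inner x y"
proof -
  have M: "M ** transpose M = mat 1" "transpose M ** M = mat 1"
    using assms by (auto simp: orthogonal_matrix_def)
  have "inner (tube_rep M x) (tube_rep M y) = trace (tube_rep M x ** tube_rep M y)"
    by (simp flip: trace_transpose_mult add: transpose_tube_rep)
  also have "tube_rep M x ** tube_rep M y
      = transpose M ** (diag (M *v x) ** (M ** transpose M) ** diag (M *v y) ** M)"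
    by (simp only: tube_rep_def matrix_mul_assoc)
  \<comment> \<open>Cyclicity of the trace moves the leading \<open>transpose M\<close> to the end,
    next to \<open>M\<close>.\<close>
  also have "trace \<dots> = trace (diag (M *v x) ** diag (M *v y) ** (M ** transpose M))"
    by (subst trace_mul_sym) (simp add: M matrix_mul_assoc [symmetric])
  also have "\<dots> = inner (M *v x) (M *v y)"
    by (simp add: M diag_mult) (simp add: trace_def diag_def inner_vec_def)
  also have "\<dots> = inner x y"
    using dot_lmul_matrix [of x "transpose M" "M *v y"] by (simp add: M matrix_vector_mul_assoc)
  finally show ?thesis .
qed

text \<open>The isometry of single blocks, summed over all blocks. It transfers objective and
  constraint values from tensors to matrices.\<close>

lemma inner_mat_rep:
  assumes "orthogonal_matrix M"
  shows "inner (mat_rep M X) (mat_rep M Y) = inner X Y"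
proof -
  have "inner (mat_rep M X) (mat_rep M Y)
      = (\<Sum>i\<in>UNIV. \<Sum>a\<in>UNIV. \<Sum>j\<in>UNIV. \<Sum>c\<in>UNIV.
          tube_rep M (X $ i $ j) $ a $ c * tube_rep M (Y $ i $ j) $ a $ c)"
    by (simp add: inner_vec_def sum_UNIV_prod mat_rep_nth)
  also have "\<dots> = (\<Sum>i\<in>UNIV. \<Sum>j\<in>UNIV. inner (tube_rep M (X $ i $ j)) (tube_rep M (Y $ i $ j)))"
    by (subst (2) sum.swap) (simp add: inner_vec_def)
  also have "\<dots> = inner X Y"
    by (simp add: inner_tube_rep assms) (simp add: inner_vec_def)
  finally show ?thesis .
qed

section \<open>Positive semidefiniteness of tensors and of their matrix representatives\<close>

lemma matrix_inv_eq_transpose: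
  assumes "orthogonal_matrix (M :: real^'k^'k)"
  shows "matrix_inv M = transpose M"
proof -
  have M: "M ** transpose M = mat 1" "transpose M ** M = mat 1"
    using assms by (auto simp: orthogonal_matrix_def)
  \<comment> \<open>\<open>matrix_inv\<close> is a choice among two-sided inverses;
    \<open>transpose M\<close> shows that one exists.\<close>
  have "M ** matrix_inv M = mat 1"
    unfolding matrix_inv_def by (rule someI2 [of _ "transpose M"]) (use M in auto)
  then have "(transpose M ** M) ** matrix_inv M = transpose M"
    by (simp flip: matrix_mul_assoc)
  then show ?thesis
    by (simp add: M)
qed

text \<open>Brings the quadratic form behind \<open>PSD\<close> to a double sum over blocks, to be
  matched with \<open>inner_mat_rep_vector\<close>.\<close>

lemma inner_tensor_prod:
  fixes X :: "('n::finite, 'n, 'k::finite) tensor" and Y :: "('n, 1, 'k) tensor"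
  assumes "orthogonal_matrix M"
  shows "inner Y (tensor_prod M X Y)
    = (\<Sum>i\<in>UNIV. \<Sum>j\<in>UNIV. inner (Y $ i $ 1) (tube_rep M (X $ i $ j) *v Y $ j $ 1))"
proof -
  have "tensor_prod M X Y $ i $ 1 = (\<Sum>j\<in>UNIV. tube_rep M (X $ i $ j) *v Y $ j $ 1)" for i
    by (simp add: tensor_prod_def tvec_def tube_prod_def tube_def tube_at_def tube_rep_def
        matrix_inv_eq_transpose [OF assms] matrix_vector_mul_assoc matrix_mul_assoc)
  then have "inner (Y $ i) (tensor_prod M X Y $ i)
      = (\<Sum>j\<in>UNIV. inner (Y $ i $ 1) (tube_rep M (X $ i $ j) *v Y $ j $ 1))" for i
    by (simp add: inner_vec_def [of "Y $ i"] UNIV_1 inner_sum_right)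
  then show ?thesis
    by (simp add: inner_vec_def [of Y])
qed

lemma inner_mat_rep_vector:
  "inner y (mat_rep M X *v y)
    = (\<Sum>i\<in>UNIV. \<Sum>j\<in>UNIV. inner (\<chi> a. y $ (i, a)) (tube_rep M (X $ i $ j) *v (\<chi> a. y $ (j, a))))"
proof -
  have "inner y (mat_rep M X *v y)
      = (\<Sum>i\<in>UNIV. \<Sum>a\<in>UNIV. \<Sum>j\<in>UNIV. y $ (i, a) * (\<Sum>c\<in>UNIV. tube_rep M (X $ i $ j) $ a $ c * y $ (j, c)))"
    by (simp add: inner_vec_def sum_UNIV_prod matrix_vector_mult_def mat_rep_nth sum_distrib_left)
  also have "\<dots> = (\<Sum>i\<in>UNIV. \<Sum>j\<in>UNIV. \<Sum>a\<in>UNIV.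
      y $ (i, a) * (\<Sum>c\<in>UNIV. tube_rep M (X $ i $ j) $ a $ c * y $ (j, c)))"
    by (subst (2) sum.swap) simp
  finally show ?thesis
    by (simp add: inner_vec_def matrix_vector_mult_def)
qed

text \<open>Stacking the tubes of \<open>Y\<close> is a bijection onto the vectors indexed by pairs,
  and it carries one quadratic form to the other.\<close>

lemma psd_matrix_mat_rep_iff:
  fixes X :: "('n::finite, 'n, 'k::finite) tensor"
  assumes "orthogonal_matrix M" and "symmetric_tensor X"
  shows "psd_matrix (mat_rep M X) \<longleftrightarrow> X \<in> PSD M"
proof -
  have "inner y (mat_rep M X *v y) = inner Y (tensor_prod M X Y)"
    if "\<And>i a. Y $ i $ 1 $ a = y $ (i, a)" for y and Y :: "('n, 1, 'k) tensor"
  proof -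
    have "Y $ i $ 1 = (\<chi> a. y $ (i, a))" for i
      by (simp add: vec_eq_iff that)
    then show ?thesis
      by (simp add: inner_tensor_prod [OF assms(1)] inner_mat_rep_vector)
  qed
  note eq = this
  have "(\<forall>y. 0 \<le> inner y (mat_rep M X *v y)) \<longleftrightarrow> (\<forall>Y :: ('n, 1, 'k) tensor. 0 \<le> inner Y (tensor_prod M X Y))"
  proof safe
    fix Y :: "('n, 1, 'k) tensor"
    assume "\<forall>y. 0 \<le> inner y (mat_rep M X *v y)"
    then have "0 \<le> inner y (mat_rep M X *v y)" for y
      by blast
    then show "0 \<le> inner Y (tensor_prod M X Y)"
      by (subst eq [of Y "\<chi> p. Y $ fst p $ 1 $ snd p", symmetric]) simp_all
  next
    fix y :: "real^('n \<times> 'k)"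
    assume "\<forall>Y :: ('n, 1, 'k) tensor. 0 \<le> inner Y (tensor_prod M X Y)"
    then have "0 \<le> inner Y (tensor_prod M X Y)" for Y :: "('n, 1, 'k) tensor"
      by blast
    then show "0 \<le> inner y (mat_rep M X *v y)"
      by (subst eq [of "\<chi> i _ a. y $ (i, a)" y]) simp_all
  qed
  then show ?thesis
    using assms(2) by (simp add: psd_matrix_def PSD_def transpose_mat_rep)
qed

text \<open>The factor \<open>mat 1\<close> makes both products act block by block, so commutation
  reduces to single blocks.\<close>

lemma mat_rep_commutes_kronecker:
  assumes "\<And>i j. tube_rep M (X $ i $ j) ** R = R ** tube_rep M (X $ i $ j)"
  shows "mat_rep M X ** kronecker (mat 1) R = kronecker (mat 1) R ** mat_rep M X"
proof -
  \<comment> \<open>Swapping makes the sum over block indices the inner one, where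
    \<open>mat 1\<close> leaves a single term.\<close>
  have "(mat_rep M X ** kronecker (mat 1) R) $ (i, a) $ (j, c) = (tube_rep M (X $ i $ j) ** R) $ a $ c"
    for i j a c
    by (simp add: matrix_matrix_mult_def sum_UNIV_prod mat_rep_nth kronecker_def mat_def)
      (subst sum.swap, simp add: if_distrib [of "\<lambda>x. x * _"] if_distrib [of "\<lambda>x. _ * x"] cong: if_cong)
  moreover have "(kronecker (mat 1) R ** mat_rep M X) $ (i, a) $ (j, c) = (R ** tube_rep M (X $ i $ j)) $ a $ c"
    for i j a c
    by (simp add: matrix_matrix_mult_def sum_UNIV_prod mat_rep_nth kronecker_def mat_def)
      (subst sum.swap, simp add: if_distrib [of "\<lambda>x. x * _"] if_distrib [of "\<lambda>x. _ * x"] cong: if_cong)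
  ultimately show ?thesis
    using assms by (simp add: vec_eq_iff)
qed

section \<open>Block-scalar matrices in a symmetry-adapted basis\<close>

lemma bij_betw_pos: "bij_betw (pos :: 'k::{finite,linorder} \<Rightarrow> nat) UNIV {..<CARD('k)}"
proof -
  \<comment> \<open>Initial segments grow strictly with \<open>k\<close>. Injectivity follows, and
    counting then makes the range all of \<open>{..<CARD('k)}\<close>.\<close>
  have "strict_mono (pos :: 'k \<Rightarrow> nat)"
    unfolding pos_def by (intro strict_monoI psubset_card_mono) auto
  then have inj: "inj (pos :: 'k \<Rightarrow> nat)"
    by (rule strict_mono_imp_inj_on)
  have "range (pos :: 'k \<Rightarrow> nat) \<subseteq> {..<CARD('k)}"
    unfolding pos_def by (auto intro!: psubset_card_mono)
  then have "range (pos :: 'k \<Rightarrow> nat) = {..<CARD('k)}"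
    by (intro card_subset_eq) (auto simp: card_image inj)
  with inj show ?thesis
    by (simp add: bij_betw_def)
qed

text \<open>Entry \<open>p\<close> is the number of the block containing position \<open>p\<close>, counted from zero.\<close>

definition block_of :: "nat list \<Rightarrow> nat list" where
  "block_of ds = concat (map2 replicate ds [0..<length ds])"

lemma length_concat_replicate:
  "length cs = length ds \<Longrightarrow> length (concat (map2 replicate ds cs)) = sum_list ds"
  by (induction ds cs rule: list_induct2') auto

lemma length_block_of: "length (block_of ds) = sum_list ds"
  by (simp add: block_of_def length_concat_replicate)

text \<open>A list is \<open>nth\<close> of itself mapped over its indices, and that map passes
  through \<open>replicate\<close> and \<open>concat\<close>. Block-scalar diagonals thus become
  functions of the block number.\<close>

lemma concat_replicate_eq_block_of:
  assumes "length cs = length ds"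
  shows "concat (map2 replicate ds cs) = map (nth cs) (block_of ds)"
proof -
  have "concat (map2 replicate ds (map f xs)) = map f (concat (map2 replicate ds xs))"
    for f :: "nat \<Rightarrow> 'a" and xs
    by (induction ds xs rule: list_induct2') auto
  from this [of "nth cs" "[0..<length cs]"] have
    "concat (map2 replicate ds cs) = map (nth cs) (concat (map2 replicate ds [0..<length cs]))"
    by (simp only: map_nth)
  then show ?thesis
    by (simp only: block_of_def assms)
qed

lemma zip_concat_block_of:
  "zip (concat bs) (block_of (map length bs)) = concat (map2 (\<lambda>b i. map (\<lambda>x. (x, i)) b) bs [0..<length bs])"
proof -
  \<comment> \<open>The index list is generalised to an arbitrary \<open>xs\<close>, since
    \<open>[0..<length bs]\<close> does not survive the induction.\<close>
  have "zip (concat bs) (concat (map2 replicate (map length bs) xs)) = concat (map2 (\<lambda>b i. map (\<lambda>x. (x, i)) b) bs xs)"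
    if "length bs = length xs" for bs :: "'a list list" and xs :: "nat list"
    using that
  proof (induction bs xs rule: list_induct2)
    case (Cons b bs x xs)
    have "zip b (replicate (length b) x) = map (\<lambda>y. (y, x)) b"
      by (induction b) auto
    with Cons show ?case
      by (simp add: zip_append)
  qed simp
  then show ?thesis
    by (simp add: block_of_def)
qed

text \<open>Translates between positions in the concatenated basis and membership in one block; both
  directions are used for the rows of \<open>M\<close>.\<close>

lemma mem_block_iff:
  "(\<exists>p<length (concat bs). concat bs ! p = v \<and> block_of (map length bs) ! p = i)
    \<longleftrightarrow> i < length bs \<and> v \<in> set (bs ! i)"
proof -
  have "(\<exists>p<length (concat bs). concat bs ! p = v \<and> block_of (map length bs) ! p = i)
      \<longleftrightarrow> (v, i) \<in> set (zip (concat bs) (block_of (map length bs)))"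
    by (auto simp: in_set_zip length_block_of length_concat)
  also have "\<dots> \<longleftrightarrow> i < length bs \<and> v \<in> set (bs ! i)"
    unfolding zip_concat_block_of by (force simp: set_zip)
  finally show ?thesis .
qed

text \<open>Replaces the list of scalars by a function of the block number, which makes closure
  under linear operations immediate.\<close>

lemma W_space_iff:
  fixes M :: "real^'k::{finite,linorder}^'k::{finite,linorder}"
  assumes "sum_list ds = CARD('k)"
  shows "x \<in> W_space M ds \<longleftrightarrow> (\<exists>f. \<forall>k. (M *v tvec x) $ k = f (block_of ds ! pos k))"
proof
  have pos: "pos k < length (block_of ds)" for k :: 'k
    using bij_betw_pos assms by (auto simp: bij_betw_def length_block_of)
  {
    assume "x \<in> W_space M ds"
    then show "\<exists>f. \<forall>k. (M *v tvec x) $ k = f (block_of ds ! pos k)"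
      by (auto simp: W_space_def block_scalar_def diag_inject concat_replicate_eq_block_of pos)
  next
    assume "\<exists>f. \<forall>k. (M *v tvec x) $ k = f (block_of ds ! pos k)"
    then obtain f where f: "\<And>k. (M *v tvec x) $ k = f (block_of ds ! pos k)"
      by blast
    \<comment> \<open>Only values of \<open>f\<close> below \<open>length ds\<close> occur, so a
      list of that length can record them.\<close>
    have "block_of ds ! p < length ds" if "p < length (block_of ds)" for p
    proof -
      have "block_of ds ! p \<in> set (block_of ds)"
        using that by simp
      then show ?thesis
        unfolding block_of_def by (auto simp: set_zip)
    qed
    then have "diag (M *v tvec x) = block_scalar ds (map f [0..<length ds])"
      by (simp add: block_scalar_def diag_inject) (simp add: vec_eq_iff concat_replicate_eq_block_of pos f)
    then show "x \<in> W_space M ds"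
      by (auto simp: W_space_def intro!: exI [of _ "map f [0..<length ds]"])
  }
qed

section \<open>Linearity of the tube and tensor spaces\<close>

lemma subspace_W_space:
  fixes M :: "real^'k::{finite,linorder}^'k::{finite,linorder}"
  assumes "sum_list ds = CARD('k)"
  shows "subspace (W_space M ds)"
  unfolding subspace_def
proof safe
  show "0 \<in> W_space M ds"
    by (auto simp: W_space_iff [OF assms] tvec_def intro!: exI [of _ "\<lambda>_. 0"])
next
  fix x y assume "x \<in> W_space M ds" "y \<in> W_space M ds"
  then obtain f g where "\<And>k. (M *v tvec x) $ k = f (block_of ds ! pos k)"
    "\<And>k. (M *v tvec y) $ k = g (block_of ds ! pos k)"
    by (auto simp: W_space_iff [OF assms])
  then show "x + y \<in> W_space M ds"
    by (auto simp: W_space_iff [OF assms] tvec_def matrix_vector_right_distrib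
        intro!: exI [of _ "\<lambda>i. f i + g i"])
next
  fix c :: real and x assume "x \<in> W_space M ds"
  then obtain f where "\<And>k. (M *v tvec x) $ k = f (block_of ds ! pos k)"
    by (auto simp: W_space_iff [OF assms])
  then show "c *\<^sub>R x \<in> W_space M ds"
    by (auto simp: W_space_iff [OF assms] tvec_def matrix_vector_mult_scaleR
        intro!: exI [of _ "\<lambda>i. c * f i"])
qed

lemma subspace_U_space:
  fixes W :: "'k::finite tube set"
  assumes "subspace W"
  shows "subspace (U_space W :: ('n::finite, 'n, 'k) tensor set)"
proof -
  have "tube_at (0 :: ('n, 'n, 'k) tensor) i j = 0" "tube_at (X + Y) i j = tube_at X i j + tube_at Y i j"
    "tube_at (c *\<^sub>R X) i j = c *\<^sub>R tube_at X i j"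
    for X Y :: "('n, 'n, 'k) tensor" and c i j
    by (simp_all add: tube_at_def tube_def vec_eq_iff)
  then show ?thesis
    using assms by (auto simp: subspace_def U_space_def symmetric_tensor_iff)
qed

text \<open>Each list is a basis of its summand without repetitions. This matches the dimensions in
  \<open>W_space\<close> with the block sizes of the basis.\<close>

lemma symmetry_adapted_basis_lengths:
  assumes "symmetry_adapted_basis G \<sigma> Vs bs"
  shows "map length bs = map vec.dim Vs"
proof (rule nth_equalityI)
  show "length (map length bs) = length (map vec.dim Vs)"
    using assms by (simp add: symmetry_adapted_basis_def)
  fix i assume "i < length (map length bs)"
  then have "i < length Vs" "i < length bs" "distinct (bs ! i)" "vec.independent (set (bs ! i))"
    "vec.span (set (bs ! i)) = Vs ! i"
    using assms by (auto simp: symmetry_adapted_basis_def)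
  then show "map length bs ! i = map vec.dim Vs ! i"
    by (metis distinct_card nth_map vec.dim_span_eq_card_independent)
qed

text \<open>In the basis given by \<open>M\<close>, \<open>tube_rep M x\<close> is diagonal. A
  matrix commutes with a diagonal one once its entries vanish wherever the two diagonal values
  differ.\<close>

lemma tube_rep_commutes:
  fixes M R :: "real^'k^'k"
  assumes M: "orthogonal_matrix M"
    and zero: "\<And>k l. (M *v x) $ k \<noteq> (M *v x) $ l \<Longrightarrow> (M ** R ** transpose M) $ k $ l = 0"
  shows "tube_rep M x ** R = R ** tube_rep M x"
proof -
  have MM: "M ** transpose M = mat 1" "transpose M ** M = mat 1"
    using M by (auto simp: orthogonal_matrix_def)
  let ?D = "diag (M *v x)" and ?R = "M ** R ** transpose M"
  have "(?D ** ?R) $ k $ l = (M *v x) $ k * ?R $ k $ l" "(?R ** ?D) $ k $ l = ?R $ k $ l * (M *v x) $ l" for k l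
    by (rule diag_mult_nth mult_diag_nth)+
  then have comm: "?D ** ?R = ?R ** ?D"
    using zero by (simp add: vec_eq_iff) (metis mult.commute mult_zero_left)
  have "tube_rep M x ** R = transpose M ** (?D ** ?R) ** M"
    by (simp add: tube_rep_def matrix_mul_assoc [symmetric] MM)
  also have "\<dots> = (transpose M ** M) ** R ** tube_rep M x"
    unfolding comm by (simp only: tube_rep_def matrix_mul_assoc)
  finally show ?thesis
    by (simp add: MM)
qed

text \<open>Entry \<open>(k, l)\<close> of \<open>M ** \<rho> g ** transpose M\<close> pairs row
  \<open>k\<close> of \<open>M\<close> with the image of row \<open>l\<close>. That image stays in
  the invariant summand of row \<open>l\<close>, which is orthogonal to row \<open>k\<close> if the
  blocks differ.\<close>

lemma W_space_commutes:
  fixes \<rho> :: "'g \<Rightarrow> real^'k::{finite,linorder}^'k::{finite,linorder}"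
  assumes M: "orthogonal_matrix M"
    and Vs: "irreducible_decomposition G (complexification \<rho>) Vs"
    and bs: "symmetry_adapted_basis G (complexification \<rho>) Vs bs"
    and len: "length (concat bs) = CARD('k)"
    and cols: "\<And>k. cvec (column k (matrix_inv M)) = concat bs ! pos k"
    and x: "x \<in> W_space M (map vec.dim Vs)"
    and g: "g \<in> carrier G"
  shows "tube_rep M (tvec x) ** \<rho> g = \<rho> g ** tube_rep M (tvec x)"
proof (rule tube_rep_commutes [OF M])
  have MM: "M ** transpose M = mat 1" "transpose M ** M = mat 1"
    using M by (auto simp: orthogonal_matrix_def)
  with cols have rows: "cvec (row k M) = concat bs ! pos k" for k
    by (simp add: matrix_inv_eq_transpose [OF M])
  define blk where "blk k = block_of (map vec.dim Vs) ! pos k" for k :: 'k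
  have lens: "map length bs = map vec.dim Vs"
    using bs by (rule symmetry_adapted_basis_lengths)
  then have "sum_list (map vec.dim Vs) = CARD('k)"
    using len by (metis length_concat)
  then obtain f where f: "\<And>k. (M *v tvec x) $ k = f (blk k)"
    using x by (auto simp: W_space_iff blk_def)
  fix k l
  assume "(M *v tvec x) $ k \<noteq> (M *v tvec x) $ l"
  then have neq: "blk k \<noteq> blk l"
    by (auto simp: f)
  \<comment> \<open>The complex-linear pairing with row \<open>k\<close>; the row is real, so
    conjugation does not enter.\<close>
  define \<phi> where "\<phi> z = (\<Sum>a\<in>UNIV. complex_of_real (M $ k $ a) * z $ a)" for z
  have block: "blk l < length bs" "cvec (row l M) \<in> set (bs ! blk l)"
  proof -
    have "pos l < length (concat bs)"
      using bij_betw_pos by (auto simp: bij_betw_def len)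
    then show "blk l < length bs" "cvec (row l M) \<in> set (bs ! blk l)"
      using mem_block_iff [of bs "cvec (row l M)" "blk l"] by (auto simp: blk_def rows lens)
  qed
  have span: "vec.span (set (bs ! blk l)) = Vs ! blk l" and "Vs ! blk l \<in> set Vs"
    using bs block(1) by (auto simp: symmetry_adapted_basis_def)
  then have "invariant_under G (complexification \<rho>) (Vs ! blk l)"
    using Vs by (simp add: irreducible_decomposition_def irreducible_subrep_def)
  moreover have "cvec (row l M) \<in> Vs ! blk l"
    unfolding span [symmetric] using block(2) by (rule vec.span_base)
  ultimately have "complexification \<rho> g *v cvec (row l M) \<in> Vs ! blk l"
    using g by (simp add: invariant_under_def)
  \<comment> \<open>The kernel of \<open>\<phi>\<close> is a complex subspace, so a check on the
    basis of the summand suffices.\<close>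
  moreover have "Vs ! blk l \<subseteq> {z. \<phi> z = 0}"
    unfolding span [symmetric]
  proof (rule vec.span_minimal)
    show "vec.subspace {z. \<phi> z = 0}"
    proof -
      have "\<phi> (y + z) = \<phi> y + \<phi> z" "\<phi> (c *s z) = c * \<phi> z" for c y z
        by (simp_all add: \<phi>_def distrib_left sum.distrib sum_distrib_left mult.left_commute)
      moreover have "\<phi> 0 = 0"
        by (simp add: \<phi>_def)
      ultimately show ?thesis
        by (simp add: vec.subspace_def)
    qed
    show "set (bs ! blk l) \<subseteq> {z. \<phi> z = 0}"
    proof
      \<comment> \<open>Each basis vector of this block is again a row of \<open>M\<close>, with the
        same block number as row \<open>l\<close>.\<close>
      fix v assume "v \<in> set (bs ! blk l)"
      then obtain p where "p < CARD('k)" "concat bs ! p = v" "block_of (map vec.dim Vs) ! p = blk l"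
        using mem_block_iff [of bs v "blk l"] block(1) by (auto simp: len lens)
      moreover from \<open>p < CARD('k)\<close> obtain j :: 'k where "pos j = p"
        using bij_betw_pos by (metis bij_betw_imp_surj_on imageE lessThan_iff)
      ultimately have j: "blk j = blk l" "v = cvec (row j M)"
        by (auto simp: blk_def rows)
      have "\<phi> v = complex_of_real ((M ** transpose M) $ k $ j)"
        by (simp add: \<phi>_def j cvec_def row_def matrix_matrix_mult_def transpose_def)
      also have "\<dots> = 0"
        using neq j by (auto simp: MM mat_def)
      finally show "v \<in> {z. \<phi> z = 0}"
        by simp
    qed
  qed
  ultimately have "\<phi> (complexification \<rho> g *v cvec (row l M)) = 0"
    by blast
  moreover have "\<phi> (complexification \<rho> g *v cvec (row l M))
      = complex_of_real ((M ** (\<rho> g ** transpose M)) $ k $ l)"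
    by (simp add: \<phi>_def complexification_def cvec_def row_def matrix_matrix_mult_def transpose_def
        matrix_vector_mult_def)
  ultimately show "(M ** \<rho> g ** transpose M) $ k $ l = 0"
    by (simp add: matrix_mul_assoc)
qed

section \<open>Invariance of the semidefinite program\<close>

text \<open>The affine space is the linear image of \<open>U_space W\<close> cut by the trace
  hyperplanes. Tensors in \<open>U_space W\<close> are symmetric, so membership in
  \<open>PSD M\<close> becomes semidefiniteness of the matrix.\<close>

lemma matrix_sdp_feasible_matrices:
  fixes C :: "('n::finite, 'n, 'k::finite) tensor"
  assumes M: "orthogonal_matrix M" and W: "subspace W" and C: "symmetric_tensor C"
  shows "matrix_sdp (mat_rep M C) (feasible_matrices M L A b (U_space W))"
proof -
  let ?S = "mat_rep M ` U_space W \<inter> (\<Inter>l\<in>{1..L}. {Z. inner (mat_rep M (A l)) Z = b l})"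
  have "affine ?S"
  proof (intro affine_Int affine_Inter ballI)
    show "affine (mat_rep M ` U_space W)"
      by (intro subspace_imp_affine linear_subspace_image linear_mat_rep subspace_U_space W)
  qed (auto simp: affine_hyperplane)
  moreover have "feasible_matrices M L A b (U_space W) = {Z \<in> ?S. psd_matrix Z}"
    using psd_matrix_mat_rep_iff [OF M]
    by (auto simp: feasible_matrices_def trace_transpose_mult U_space_def)
  ultimately show ?thesis
    using C by (auto simp: matrix_sdp_def transpose_mat_rep)
qed

theorem theorem4p6:
  fixes G :: "('g, 'h) monoid_scheme"
    and \<rho> :: "'g \<Rightarrow> real^'k::{finite,linorder}^'k::{finite,linorder}"
    and Vs :: "(complex^'k::{finite,linorder}) set list"
    and M :: "real^'k::{finite,linorder}^'k::{finite,linorder}"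
    and C :: "('n::finite, 'n, 'k) tensor"
    and L :: nat
    and A :: "nat \<Rightarrow> ('n, 'n, 'k) tensor"
    and b :: "nat \<Rightarrow> real"
  assumes "group G" and "finite (carrier G)"
    and "\<rho> \<in> hom G GL"
    and "totally_real G (complexification \<rho>)"
    and "\<And>g. g \<in> carrier G \<Longrightarrow> orthogonal_matrix (\<rho> g)"
    and "irreducible_decomposition G (complexification \<rho>) Vs"
    and "orthogonal_matrix M"
    and "represents_symmetry_adapted G \<rho> Vs M"
    and "symmetric_tensor C"
    and "\<And>l. l \<in> {1..L} \<Longrightarrow> symmetric_tensor (A l)"
  shows "invariant_M_sdp G (\<lambda>g. kronecker (mat 1) (\<rho> g)) M C L A b
           (U_space (W_space M (map vec.dim Vs)))"
proof -
  note \<rho> = assms(3) and orth = assms(5) and M = assms(7) and C = assms(9) and A = assms(10)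
  obtain bs where bs: "symmetry_adapted_basis G (complexification \<rho>) Vs bs"
    and len: "length (concat bs) = CARD('k)"
    and cols: "\<And>k. cvec (column k (matrix_inv M)) = concat bs ! pos k"
    using assms(8) by (auto simp: represents_symmetry_adapted_def)
  let ?ds = "map vec.dim Vs"
  let ?\<Omega> = "feasible_matrices M L A b (U_space (W_space M ?ds))"
  have "sum_list ?ds = CARD('k)"
    using len symmetry_adapted_basis_lengths [OF bs] by (metis length_concat)
  then have sdp: "matrix_sdp (mat_rep M C) ?\<Omega>"
    by (intro matrix_sdp_feasible_matrices M C subspace_W_space)
  \<comment> \<open>Pointwise triviality of the action yields invariance of the feasible region and
    of the objective together.\<close>
  have act: "act (kronecker (mat 1) (\<rho> g)) Z = Z" if g: "g \<in> carrier G" and "Z \<in> ?\<Omega>" for g Z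
  proof -
    obtain X where X: "Z = mat_rep M X" "X \<in> U_space (W_space M ?ds)"
      using \<open>Z \<in> ?\<Omega>\<close> by (auto simp: feasible_matrices_def)
    have "tube_rep M (X $ i $ j) ** \<rho> g = \<rho> g ** tube_rep M (X $ i $ j)" for i j
      using W_space_commutes [OF M assms(6) bs len cols _ g, of "tube_at X i j"] X(2)
      by (simp add: U_space_def tvec_def tube_at_def tube_def)
    \<comment> \<open>Commutation brings the right factor next to its transpose, where orthogonality
      of \<open>\<rho> g\<close> cancels both.\<close>
    then have "act (kronecker (mat 1) (\<rho> g)) Z
        = transpose (kronecker (mat 1) (\<rho> g)) ** kronecker (mat 1) (\<rho> g) ** Z"
      by (simp add: act_def X(1) mat_rep_commutes_kronecker flip: matrix_mul_assoc)
    also have "\<dots> = Z"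
      using orth [OF g]
      by (simp add: transpose_kronecker kronecker_mult kronecker_mat_1 orthogonal_matrix_def)
    finally show ?thesis .
  qed
  \<comment> \<open>Symmetry of \<open>B\<close> removes the transpose from the Frobenius
    form.\<close>
  have "inner B X = trace (mat_rep M B ** mat_rep M X)" if "symmetric_tensor B"
    for B X :: "('n, 'n, 'k) tensor"
    using inner_mat_rep [OF M, of B X] trace_transpose_mult [of "mat_rep M B" "mat_rep M X"]
    by (simp add: transpose_mat_rep that)
  then show ?thesis
    using C A act sdp kronecker_hom [OF \<rho>]
    unfolding invariant_M_sdp_def invariant_matrix_sdp_def by simp
qed

end
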